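(* Let $0<\epsilon<\frac12$ and $f:\mathcal X\times\mathcal Y\to\{0,1\}^k$. Let $R=R^{\mathrm{spt},\mathrm{priv}}_\epsilon(f)$ and $M=16\left(\frac12-\epsilon\right)^{-2}2^R$. Then if $\epsilon<\frac13$, $$D^{\mathrm{spt}}(f)\le 2^{R+1}\left(R+\log\left(\frac4{\frac13-\epsilon}\right)+1\right)+k,$$ and for all $\epsilon<\frac12$, $$D^{\mathrm{spt}}(f)\le 2^{R+1}\left(R+\log\left(\frac8{\frac12-\epsilon}\right)+1\right)+k\left(\frac{5-2\epsilon}4M+1\right).$$
   Context: Two-party communication: Alice receives $x$, Bob $y$; transcript $t_\pi$ = exchanged bits; cost = maximum number of bits exchanged. Split model with error $\epsilon$: Alice's output map (depending on $t_\pi$, her randomness, $x$) and Bob's (depending on $t_\pi$, his randomness, $y$) take values in $\{0,1,*\}^k$, and for every $(x,y)$, $\Pr[O_A\bowtie O_B=f(x,y)]\ge1-\epsilon$, where $(a\bowtie b)_i=a_i$ if $b_i=*$, $b_i$ if $a_i=*$, and $*$ otherwise. $R^{\mathrm{spt},\mathrm{priv}}_\epsilon(f)$ is the minimum cost of such a protocol using only private randomness; $D^{\mathrm{spt}}(f)$ is the minimum cost of a deterministic zero-error protocol in this model. Logarithms are base 2. *)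

theory Defs
  imports "HOL-Probability.Probability"
begin

text \<open>
  A protocol tree. The type \<^typ>\<open>'a\<close> is everything Alice sees privately: her input in a
  deterministic protocol, her input together with her randomness in a private-coin one;
  likewise \<^typ>\<open>'b\<close> for Bob. The two subtrees are the continuations after the bit
  False and the bit True, respectively.
\<close>

datatype ('a, 'b) protocol =
    Done
  | Alice_Sends "'a \<Rightarrow> bool" "('a, 'b) protocol" "('a, 'b) protocol"
  | Bob_Sends "'b \<Rightarrow> bool" "('a, 'b) protocol" "('a, 'b) protocol"

primrec transcript :: "('a, 'b) protocol \<Rightarrow> 'a \<Rightarrow> 'b \<Rightarrow> bool list" where
  "transcript Done a b = []"
| "transcript (Alice_Sends g p q) a b = g a # (if g a then transcript q a b else transcript p a b)"
| "transcript (Bob_Sends h p q) a b = h b # (if h b then transcript q a b else transcript p a b)"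

text \<open>\<open>S\<close> and \<open>T\<close> are the private views that can occur.\<close>

definition cost :: "'a set \<Rightarrow> 'b set \<Rightarrow> ('a, 'b) protocol \<Rightarrow> nat" where
  "cost S T p = Max {length (transcript p a b) | a b. a \<in> S \<and> b \<in> T}"

text \<open>The symbol * is \<^const>\<open>None\<close>, and the dimension k is \<open>CARD('k)\<close>.\<close>

definition weave :: "bool option ^ 'k \<Rightarrow> bool option ^ 'k \<Rightarrow> bool option ^ 'k"
    (infixl "\<bowtie>" 65) where
  "u \<bowtie> v = (\<chi> i. if v $ i = None then u $ i else if u $ i = None then v $ i else None)"

type_synonym ('a, 'k) output_map = "bool list \<Rightarrow> 'a \<Rightarrow> bool option ^ 'k"

definition split_output ::
    "('a, 'b) protocol \<Rightarrow> ('a, 'k) output_map \<Rightarrow> ('b, 'k) output_map \<Rightarrow> 'a \<Rightarrow> 'b \<Rightarrow> bool option ^ 'k"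
    where
  "split_output p outA outB a b = outA (transcript p a b) a \<bowtie> outB (transcript p a b) b"

definition computes_det ::
    "('x \<Rightarrow> 'y \<Rightarrow> bool ^ 'k) \<Rightarrow> ('x, 'y) protocol \<Rightarrow> ('x, 'k) output_map \<Rightarrow> ('y, 'k) output_map \<Rightarrow> bool"
    where
  "computes_det f p outA outB \<longleftrightarrow>
     (\<forall>x y. split_output p outA outB x y = (\<chi> i. Some (f x y $ i)))"

text \<open>
  Alice and Bob independently draw their private randomness from \<open>A\<close> and \<open>B\<close>. Discrete
  randomness on \<^typ>\<open>nat\<close> loses no generality, even for uncountable input types: for a fixed
  input a party's behaviour takes finitely many values, and any distribution on a finite set is
  the image of one fixed discrete distribution, such as that of finitely many independent
  geometric variables, encoded as a natural number.
\<close>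

definition computes_priv ::
    "real \<Rightarrow> ('x \<Rightarrow> 'y \<Rightarrow> bool ^ 'k) \<Rightarrow> nat pmf \<Rightarrow> nat pmf \<Rightarrow> ('x \<times> nat, 'y \<times> nat) protocol
       \<Rightarrow> ('x \<times> nat, 'k) output_map \<Rightarrow> ('y \<times> nat, 'k) output_map \<Rightarrow> bool" where
  "computes_priv \<epsilon> f A B p outA outB \<longleftrightarrow>
     (\<forall>x y. measure_pmf.prob (pair_pmf A B)
        {(r, s). split_output p outA outB (x, r) (y, s) = (\<chi> i. Some (f x y $ i))} \<ge> 1 - \<epsilon>)"

text \<open>
  The input types need not be finite, so there may be no protocol at all; the complexity is
  then \<^term>\<open>\<infinity> :: enat\<close>. Otherwise the infimum is a minimum.
\<close>

definition D_spt :: "('x \<Rightarrow> 'y \<Rightarrow> bool ^ 'k) \<Rightarrow> enat" where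
  "D_spt f = Inf {enat (cost UNIV UNIV p) | p outA outB. computes_det f p outA outB}"

definition R_spt_priv :: "real \<Rightarrow> ('x \<Rightarrow> 'y \<Rightarrow> bool ^ 'k) \<Rightarrow> enat" where
  "R_spt_priv \<epsilon> f =
     Inf {enat (cost (UNIV \<times> set_pmf A) (UNIV \<times> set_pmf B) p) | A B p outA outB.
            computes_priv \<epsilon> f A B p outA outB}"

end

theory Submission imports Defs
begin

text \<open>
  For inputs \<open>x\<close>, \<open>y\<close> a transcript \<open>t\<close> occurs with probability
  \<open>a\<^sub>t(x) b\<^sub>t(y)\<close>, and at most \<open>2 ^ R\<close> transcripts can occur. So the parties can tell
  each other these factors, rounded to \<open>n\<close> bits, and each then knows the distribution of the
  transcript up to an error \<open>2 ^ R / 2 ^ n\<close> in total variation.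

  If \<open>\<epsilon> < 1/3\<close>, then for every coordinate one of the parties announces the correct bit
  with probability at least \<open>(1 - \<epsilon>) / 2 > 1/3\<close>, whereas each announces the wrong
  bit with probability at most \<open>\<epsilon> < 1/3\<close>. One further bit per coordinate tells Bob
  whether it is Alice who knows the value.

  For \<open>\<epsilon> < 1/2\<close> Alice also sends, for every coordinate and every transcript, her rounded output
  distribution conditioned on that transcript. A constant precision (independent of \<open>R\<close>) suffices
  for this, and Bob outputs the majority value of every coordinate.
\<close>

section \<open>Transcripts and costs\<close>

text \<open>At every node the bit depends on the view of one party only, so a run that mixes
  \<open>a\<close> with \<open>b\<close> follows the same path as the two witnessing runs. Thus the
  views with transcript \<open>t\<close> form a combinatorial rectangle.\<close>

lemma transcript_rectangle:
  "transcript p a b = t \<longleftrightarrow> (\<exists>b'. transcript p a b' = t) \<and> (\<exists>a'. transcript p a' b = t)"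
proof -
  have "transcript p a b' = t \<Longrightarrow> transcript p a' b = t \<Longrightarrow> transcript p a b = t" for a' b'
    by (induction p arbitrary: t) (auto split: if_splits)
  then show ?thesis by blast
qed

lemma transcript_bounded: "\<exists>N. \<forall>a b. length (transcript p a b) \<le> N"
proof (induction p)
  case Done
  then show ?case by simp
next
  case (Alice_Sends g p q)
  then obtain N N' where "\<forall>a b. length (transcript p a b) \<le> N" "\<forall>a b. length (transcript q a b) \<le> N'"
    by blast
  then show ?case by (intro exI[of _ "Suc (max N N')"]) (auto simp: le_max_iff_disj)
next
  case (Bob_Sends g p q)
  then obtain N N' where "\<forall>a b. length (transcript p a b) \<le> N" "\<forall>a b. length (transcript q a b) \<le> N'"
    by blast
  then show ?case by (intro exI[of _ "Suc (max N N')"]) (auto simp: le_max_iff_disj)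
qed

lemma finite_transcript_lengths: "finite {length (transcript p a b) | a b. a \<in> S \<and> b \<in> T}"
proof -
  obtain N where "\<forall>a b. length (transcript p a b) \<le> N"
    using transcript_bounded by blast
  then have "{length (transcript p a b) | a b. a \<in> S \<and> b \<in> T} \<subseteq> {..N}" by auto
  then show ?thesis using finite_subset by blast
qed

lemma length_transcript_le_cost:
  "a \<in> S \<Longrightarrow> b \<in> T \<Longrightarrow> length (transcript p a b) \<le> cost S T p"
  unfolding cost_def by (rule Max_ge[OF finite_transcript_lengths]) blast

lemma cost_le:
  assumes "\<And>a b. length (transcript p a b) \<le> c"
  shows "cost UNIV UNIV p \<le> c"
  unfolding cost_def using assms by (subst Max_le_iff[OF finite_transcript_lengths]) auto

text \<open>The views are restricted to \<open>Z\<close> because a branch that no occurring view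
  reaches may be arbitrarily long. The first bit splits \<open>Z\<close> into two parts, each with
  one bit less to spend.\<close>

lemma transcripts_card:
  assumes "\<And>a b. (a, b) \<in> Z \<Longrightarrow> length (transcript p a b) \<le> R"
  shows "finite ((\<lambda>(a, b). transcript p a b) ` Z) \<and> card ((\<lambda>(a, b). transcript p a b) ` Z) \<le> 2 ^ R"
  using assms
proof (induction p arbitrary: Z R)
  case Done
  have sub: "(\<lambda>(a, b). transcript Done a b) ` Z \<subseteq> {[]}" by auto
  have "card ((\<lambda>(a, b). transcript Done a b) ` Z) \<le> 1"
    using card_mono[OF _ sub] by simp
  also have "\<dots> \<le> 2 ^ R" by simp
  finally show ?case using finite_subset[OF sub] by simp
next
  case (Alice_Sends g p q)
  show ?case
  proof (cases "Z = {}")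
    case False
    then obtain a b where "(a, b) \<in> Z" by auto
    \<comment> \<open>A pair in \<open>Z\<close> exchanges at least one bit here, so
      \<open>R\<close> is positive.\<close>
    with Alice_Sends.prems[of a b] obtain R' where R: "R = Suc R'"
      by (cases R) auto
    define P where "P = (\<lambda>(a, b). transcript p a b) ` {(a, b) \<in> Z. \<not> g a}"
    define Q where "Q = (\<lambda>(a, b). transcript q a b) ` {(a, b) \<in> Z. g a}"
    have P: "finite P \<and> card P \<le> 2 ^ R'" unfolding P_def
      using Alice_Sends.prems R by (intro Alice_Sends.IH) fastforce
    have Q: "finite Q \<and> card Q \<le> 2 ^ R'" unfolding Q_def
      using Alice_Sends.prems R by (intro Alice_Sends.IH) fastforce
    let ?F = "\<lambda>(a, b). transcript (Alice_Sends g p q) a b"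
    have "?F ` Z = ?F ` {(a, b) \<in> Z. \<not> g a} \<union> ?F ` {(a, b) \<in> Z. g a}"
      unfolding image_Un[symmetric] by (rule arg_cong[where f = "image ?F"]) auto
    moreover have "?F ` {(a, b) \<in> Z. \<not> g a} = (#) False ` P"
      unfolding P_def image_image by (rule image_cong) auto
    moreover have "?F ` {(a, b) \<in> Z. g a} = (#) True ` Q"
      unfolding Q_def image_image by (rule image_cong) auto
    ultimately have eq: "?F ` Z = (#) False ` P \<union> (#) True ` Q"
      by simp
    have "card ((#) False ` P \<union> (#) True ` Q) \<le> card P + card Q"
      using P Q by (intro order_trans[OF card_Un_le] add_mono card_image_le) auto
    then show ?thesis unfolding eq using P Q R by simp
  qed simp
next
  case (Bob_Sends g p q)
  show ?case
  proof (cases "Z = {}")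
    case False
    then obtain a b where "(a, b) \<in> Z" by auto
    with Bob_Sends.prems[of a b] obtain R' where R: "R = Suc R'"
      by (cases R) auto
    define P where "P = (\<lambda>(a, b). transcript p a b) ` {(a, b) \<in> Z. \<not> g b}"
    define Q where "Q = (\<lambda>(a, b). transcript q a b) ` {(a, b) \<in> Z. g b}"
    have P: "finite P \<and> card P \<le> 2 ^ R'" unfolding P_def
      using Bob_Sends.prems R by (intro Bob_Sends.IH) fastforce
    have Q: "finite Q \<and> card Q \<le> 2 ^ R'" unfolding Q_def
      using Bob_Sends.prems R by (intro Bob_Sends.IH) fastforce
    let ?F = "\<lambda>(a, b). transcript (Bob_Sends g p q) a b"
    have "?F ` Z = ?F ` {(a, b) \<in> Z. \<not> g b} \<union> ?F ` {(a, b) \<in> Z. g b}"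
      unfolding image_Un[symmetric] by (rule arg_cong[where f = "image ?F"]) auto
    moreover have "?F ` {(a, b) \<in> Z. \<not> g b} = (#) False ` P"
      unfolding P_def image_image by (rule image_cong) auto
    moreover have "?F ` {(a, b) \<in> Z. g b} = (#) True ` Q"
      unfolding Q_def image_image by (rule image_cong) auto
    ultimately have eq: "?F ` Z = (#) False ` P \<union> (#) True ` Q"
      by simp
    have "card ((#) False ` P \<union> (#) True ` Q) \<le> card P + card Q"
      using P Q by (intro order_trans[OF card_Un_le] add_mono card_image_le) auto
    then show ?thesis unfolding eq using P Q R by simp
  qed simp
qed

section \<open>Deterministic protocols with few rounds\<close>

text \<open>A full binary tree of depth \<open>c\<close> whose leaf \<open>bs\<close> carries the
  continuation \<open>P bs\<close>, so that later rounds may depend on the message.\<close>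

primrec alice_message ::
    "nat \<Rightarrow> ('a \<Rightarrow> bool list) \<Rightarrow> (bool list \<Rightarrow> ('a, 'b) protocol) \<Rightarrow> ('a, 'b) protocol" where
  "alice_message 0 m P = P []"
| "alice_message (Suc c) m P = Alice_Sends (\<lambda>a. hd (m a))
     (alice_message c (\<lambda>a. tl (m a)) (\<lambda>bs. P (False # bs)))
     (alice_message c (\<lambda>a. tl (m a)) (\<lambda>bs. P (True # bs)))"

primrec bob_message ::
    "nat \<Rightarrow> ('b \<Rightarrow> bool list) \<Rightarrow> (bool list \<Rightarrow> ('a, 'b) protocol) \<Rightarrow> ('a, 'b) protocol" where
  "bob_message 0 m P = P []"
| "bob_message (Suc c) m P = Bob_Sends (\<lambda>b. hd (m b))
     (bob_message c (\<lambda>b. tl (m b)) (\<lambda>bs. P (False # bs)))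
     (bob_message c (\<lambda>b. tl (m b)) (\<lambda>bs. P (True # bs)))"

lemma transcript_alice_message:
  "length (m a) = c \<Longrightarrow> transcript (alice_message c m P) a b = m a @ transcript (P (m a)) a b"
proof (induction c arbitrary: m P)
  case (Suc c)
  then obtain z zs where "m a = z # zs" by (cases "m a") auto
  with Suc.prems Suc.IH[of "\<lambda>a. tl (m a)"] show ?case by (cases z) auto
qed simp

lemma transcript_bob_message:
  "length (m b) = c \<Longrightarrow> transcript (bob_message c m P) a b = m b @ transcript (P (m b)) a b"
proof (induction c arbitrary: m P)
  case (Suc c)
  then obtain z zs where "m b = z # zs" by (cases "m b") auto
  with Suc.prems Suc.IH[of "\<lambda>b. tl (m b)"] show ?case by (cases z) auto
qed simp

lemma bool_list_encoding:
  assumes "finite V" "card V \<le> 2 ^ c"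
  obtains e :: "'m \<Rightarrow> bool list" where "inj_on e V" "\<And>v. length (e v) = c"
proof -
  let ?W = "{bs :: bool list. length bs = c}"
  have W: "finite ?W" "card ?W = 2 ^ c"
    using finite_lists_length_eq[of "UNIV :: bool set" c] card_lists_length_eq[of "UNIV :: bool set" c]
    by auto
  obtain e where e: "inj_on e V" "e ` V \<subseteq> ?W"
    using card_le_inj[OF assms(1) W(1)] assms(2) W(2) by auto
  \<comment> \<open>Arguments outside \<open>V\<close> get a dummy word, so that all codewords have
    length \<open>c\<close>.\<close>
  define e' where "e' = (\<lambda>v. if v \<in> V then e v else replicate c False)"
  have "inj_on e' V" using e(1) by (auto simp: inj_on_def e'_def)
  moreover have "length (e' v) = c" for v using e(2) by (auto simp: e'_def)
  ultimately show thesis using that by blast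
qed

text \<open>Alice sends \<open>h x\<close>, Bob replies \<open>h' y\<close>, and Alice adds
  \<open>z (h' y) x\<close>. The codes have fixed lengths, so the transcript can be cut into its
  three blocks and decoded.\<close>

lemma D_spt_le_three_rounds:
  fixes f :: "'x \<Rightarrow> 'y \<Rightarrow> bool ^ 'k" and h :: "'x \<Rightarrow> 'm" and h' :: "'y \<Rightarrow> 'n" and z :: "'n \<Rightarrow> 'x \<Rightarrow> 'z"
  assumes "range h \<subseteq> V" "finite V" "card V \<le> 2 ^ c"
    and "range h' \<subseteq> V'" "finite V'" "card V' \<le> 2 ^ c'"
    and "range (case_prod z) \<subseteq> W" "finite W" "card W \<le> 2 ^ d"
    and out: "\<And>x y i. (oa (h' y) x \<bowtie> ob (h x) (z (h' y) x) y) $ i = Some (f x y $ i)"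
  shows "D_spt f \<le> enat (c + c' + d)"
proof -
  obtain e :: "'m \<Rightarrow> bool list" where e: "inj_on e V" "\<And>v. length (e v) = c"
    using bool_list_encoding assms by metis
  obtain e' :: "'n \<Rightarrow> bool list" where e': "inj_on e' V'" "\<And>v. length (e' v) = c'"
    using bool_list_encoding assms by metis
  obtain e'' :: "'z \<Rightarrow> bool list" where e'': "inj_on e'' W" "\<And>v. length (e'' v) = d"
    using bool_list_encoding assms by metis
  define p :: "('x, 'y) protocol" where
    "p = alice_message c (\<lambda>x. e (h x)) (\<lambda>_. bob_message c' (\<lambda>y. e' (h' y))
          (\<lambda>bs. alice_message d (\<lambda>x. e'' (z (inv_into V' e' bs) x)) (\<lambda>_. Done)))"
  have dec: "inv_into V e (e (h x)) = h x" "inv_into V' e' (e' (h' y)) = h' y"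
      "inv_into W e'' (e'' (z n x)) = z n x" for x y n
    using assms(1,4,7) e e' e'' by (force intro!: inv_into_f_f)+
  have tr: "transcript p x y = e (h x) @ e' (h' y) @ e'' (z (h' y) x)" for x y
    using dec e(2) e'(2) e''(2) by (simp add: p_def transcript_alice_message transcript_bob_message)
  define outA where "outA = (\<lambda>t x. oa (inv_into V' e' (take c' (drop c t))) x)"
  define outB where
    "outB = (\<lambda>t y. ob (inv_into V e (take c t)) (inv_into W e'' (drop (c + c') t)) y)"
  have "computes_det f p outA outB"
    unfolding computes_det_def split_output_def outA_def outB_def tr
    using out e(2) e'(2) e''(2) by (simp add: dec vec_eq_iff)
  then have "D_spt f \<le> enat (cost UNIV UNIV p)"
    unfolding D_spt_def by (intro Inf_lower) auto
  also have "cost UNIV UNIV p \<le> c + c' + d"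
    by (rule cost_le) (simp add: tr e(2) e'(2) e''(2))
  finally show ?thesis by simp
qed

lemma weave_eq_Some_iff:
  "(u \<bowtie> v) $ i = Some b \<longleftrightarrow> u $ i = Some b \<and> v $ i = None \<or> u $ i = None \<and> v $ i = Some b"
  by (auto simp: weave_def)

section \<open>Rounding\<close>

definition grid :: "nat \<Rightarrow> real set" where
  "grid n = (\<lambda>j. real j / 2 ^ n) ` {..<2 ^ n}"

text \<open>Rounding down, except that the cap sends 1 to the last grid point: the grid omits 1 so
  that a point takes exactly \<open>n\<close> bits.\<close>

definition rnd :: "nat \<Rightarrow> real \<Rightarrow> real" where
  "rnd n z = real (min (2 ^ n - 1) (nat \<lfloor>2 ^ n * z\<rfloor>)) / 2 ^ n"

lemma rnd_in_grid: "rnd n z \<in> grid n"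
  unfolding rnd_def grid_def by (rule imageI) (simp add: min_less_iff_disj)

lemma grid_bounds: "z \<in> grid n \<Longrightarrow> 0 \<le> z \<and> z \<le> 1"
  unfolding grid_def by (auto simp: divide_simps)

lemma rnd_error:
  assumes "0 \<le> z" "z \<le> 1"
  shows "\<bar>rnd n z - z\<bar> \<le> 1 / 2 ^ n"
proof -
  let ?w = "2 ^ n * z"
  have w: "0 \<le> ?w" "?w \<le> 2 ^ n" using assms by (auto simp: mult_left_le)
  have "real (nat \<lfloor>?w\<rfloor>) \<le> ?w" "?w \<le> real (nat \<lfloor>?w\<rfloor>) + 1"
    using w by linarith+
  moreover have "real (2 ^ n - 1) = 2 ^ n - (1::real)" by (simp add: of_nat_diff)
  ultimately have "\<bar>real (min (2 ^ n - 1) (nat \<lfloor>?w\<rfloor>)) - ?w\<bar> \<le> 1"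
    using w unfolding of_nat_min by linarith
  moreover have "rnd n z - z = (real (min (2 ^ n - 1) (nat \<lfloor>?w\<rfloor>)) - ?w) / 2 ^ n"
    unfolding rnd_def by (simp add: diff_divide_distrib)
  ultimately show ?thesis by (simp add: divide_right_mono)
qed

lemma card_PiE_grid:
  assumes "finite I"
  shows "finite (PiE I (\<lambda>_. grid n)) \<and> card (PiE I (\<lambda>_. grid n)) \<le> 2 ^ (n * card I)"
proof -
  have "card (grid n) \<le> card {..<2 ^ n :: nat}"
    unfolding grid_def by (rule card_image_le) simp
  then have "card (grid n) \<le> 2 ^ n" by simp
  then have "card (grid n) ^ card I \<le> (2 ^ n) ^ card I" by (rule power_mono) simp
  then show ?thesis
    using assms by (simp add: card_PiE power_mult finite_PiE grid_def)
qed

lemma rounding_bits: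
  fixes C :: real
  assumes "1 \<le> C"
  obtains n :: nat where "real n \<le> real R + log 2 C + 1" "2 ^ R / 2 ^ n \<le> 1 / C"
proof
  let ?L = "real R + log 2 C"
  \<comment> \<open>This integer lies between \<open>?L\<close> and \<open>?L + 1\<close>.\<close>
  let ?n = "nat \<lfloor>?L + 1\<rfloor>"
  have "0 \<le> log 2 C" using assms by simp
  then show "real ?n \<le> ?L + 1" by linarith
  have "?L \<le> real ?n" using \<open>0 \<le> log 2 C\<close> by linarith
  then have "2 powr ?L \<le> 2 powr real ?n" by simp
  moreover have "2 powr ?L = 2 ^ R * C" using assms by (simp add: powr_add powr_realpow)
  ultimately have "2 ^ R * C \<le> 2 ^ ?n" by (simp add: powr_realpow)
  then show "2 ^ R / 2 ^ ?n \<le> 1 / C" using assms by (simp add: field_simps)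
qed

section \<open>The transcript distribution of a private-coin protocol\<close>

locale private_protocol =
  fixes \<epsilon> :: real and f :: "'x \<Rightarrow> 'y \<Rightarrow> bool ^ 'k" and A B :: "nat pmf"
    and p :: "('x \<times> nat, 'y \<times> nat) protocol"
    and outA :: "('x \<times> nat, 'k) output_map" and outB :: "('y \<times> nat, 'k) output_map"
    and R :: nat
  assumes computes: "computes_priv \<epsilon> f A B p outA outB"
    and R_eq: "R = cost (UNIV \<times> set_pmf A) (UNIV \<times> set_pmf B) p"
begin

definition transcripts :: "bool list set" where
  "transcripts = (\<lambda>(a, b). transcript p a b) ` ((UNIV \<times> set_pmf A) \<times> (UNIV \<times> set_pmf B))"

lemma transcripts: "finite transcripts" "card transcripts \<le> 2 ^ R"
  using transcripts_card[of "(UNIV \<times> set_pmf A) \<times> (UNIV \<times> set_pmf B)" p R]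
    length_transcript_le_cost[of _ "UNIV \<times> set_pmf A" _ "UNIV \<times> set_pmf B" p]
  unfolding transcripts_def R_eq by (auto simp: mem_Times_iff)

lemma card_transcripts: "real (card transcripts) \<le> 2 ^ R"
  using transcripts(2) by (metis of_nat_le_iff of_nat_numeral of_nat_power)

text \<open>With \<open>U = UNIV\<close> this is Alice's factor in the probability of
  \<open>t\<close>. The view \<open>b\<close> is arbitrary, so the factor does not depend on Bob's
  input.\<close>

definition a_out :: "'x \<Rightarrow> bool list \<Rightarrow> (bool option ^ 'k) set \<Rightarrow> real" where
  "a_out x t U = measure_pmf.prob A {r. (\<exists>b. transcript p (x, r) b = t) \<and> outA t (x, r) \<in> U}"

definition b_out :: "'y \<Rightarrow> bool list \<Rightarrow> (bool option ^ 'k) set \<Rightarrow> real" where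
  "b_out y t U = measure_pmf.prob B {s. (\<exists>a. transcript p a (y, s) = t) \<and> outB t (y, s) \<in> U}"

definition out_prob :: "'x \<Rightarrow> 'y \<Rightarrow> ((bool option ^ 'k) \<times> (bool option ^ 'k)) set \<Rightarrow> real" where
  "out_prob x y U = measure_pmf.prob (pair_pmf A B)
     {(r, s). (outA (transcript p (x, r) (y, s)) (x, r), outB (transcript p (x, r) (y, s)) (y, s)) \<in> U}"

lemma a_out_bounds: "0 \<le> a_out x t U" "a_out x t U \<le> 1" "a_out x t U \<le> a_out x t UNIV"
  unfolding a_out_def by (auto intro!: measure_pmf.finite_measure_mono)

lemma b_out_bounds: "0 \<le> b_out y t U" "b_out y t U \<le> 1" "b_out y t U \<le> b_out y t UNIV"
  unfolding b_out_def by (auto intro!: measure_pmf.finite_measure_mono)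

lemma b_out_disjoint: "U \<inter> V = {} \<Longrightarrow> b_out y t U + b_out y t V \<le> b_out y t UNIV"
proof -
  assume "U \<inter> V = {}"
  then have "b_out y t U + b_out y t V = b_out y t (U \<union> V)"
    unfolding b_out_def
    by (subst measure_pmf.finite_measure_Union[symmetric]) (auto intro!: arg_cong[where f = "measure_pmf.prob B"])
  then show ?thesis using b_out_bounds(3) by simp
qed

lemma out_prob_bounds: "0 \<le> out_prob x y U" "out_prob x y U \<le> 1"
  unfolding out_prob_def by auto

lemma out_prob_mono: "U \<subseteq> V \<Longrightarrow> out_prob x y U \<le> out_prob x y V"
  unfolding out_prob_def by (rule measure_pmf.finite_measure_mono) auto

lemma out_prob_Un_le: "out_prob x y (U \<union> V) \<le> out_prob x y U + out_prob x y V"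
  unfolding out_prob_def
  by (rule order_trans[OF _ measure_Un_le]) (auto intro!: measure_pmf.finite_measure_mono)

lemma out_prob_Un: "U \<inter> V = {} \<Longrightarrow> out_prob x y (U \<union> V) = out_prob x y U + out_prob x y V"
  unfolding out_prob_def
  by (subst measure_pmf.finite_measure_Union[symmetric])
    (auto intro!: arg_cong[where f = "measure_pmf.prob (pair_pmf A B)"])

text \<open>For each transcript the event is a rectangle in the two independent random strings, so
  its probability factors.\<close>

lemma out_prob_product: "out_prob x y (U \<times> V) = (\<Sum>t\<in>transcripts. a_out x t U * b_out y t V)"
proof -
  let ?tr = "\<lambda>r s. transcript p (x, r) (y, s)"
  let ?P = "measure_pmf.prob (pair_pmf A B)"
  define E where "E = (\<lambda>t. {r. (\<exists>b. transcript p (x, r) b = t) \<and> outA t (x, r) \<in> U}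
      \<times> {s. (\<exists>a. transcript p a (y, s) = t) \<and> outB t (y, s) \<in> V})"
  have E: "E t = {(r, s). ?tr r s = t \<and> outA t (x, r) \<in> U \<and> outB t (y, s) \<in> V}" for t
    unfolding E_def using transcript_rectangle[of p "(x, _)" "(y, _)" t] by blast
  \<comment> \<open>Equality holds only almost surely: randomness outside the supports may produce
    other transcripts.\<close>
  have "out_prob x y (U \<times> V) = ?P (\<Union>t\<in>transcripts. E t)"
    unfolding out_prob_def
    by (rule measure_pmf.finite_measure_eq_AE)
      (auto simp: E AE_measure_pmf_iff transcripts_def image_iff)
  also have "\<dots> = (\<Sum>t\<in>transcripts. ?P (E t))"
    by (rule measure_pmf.finite_measure_finite_Union)
      (use transcripts in \<open>auto simp: disjoint_family_on_def E\<close>)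
  also have "\<dots> = (\<Sum>t\<in>transcripts. a_out x t U * b_out y t V)"
    unfolding a_out_def b_out_def E_def by (simp add: measure_pmf_prob_product)
  finally show ?thesis .
qed

lemma out_prob_UNIV: "(\<Sum>t\<in>transcripts. a_out x t UNIV * b_out y t UNIV) = 1"
  using out_prob_product[of x y UNIV UNIV] by (simp add: out_prob_def)

lemma out_prob_correct: "1 - \<epsilon> \<le> out_prob x y {(u, v). (u \<bowtie> v) $ i = Some (f x y $ i)}"
proof -
  have "1 - \<epsilon> \<le> measure_pmf.prob (pair_pmf A B)
        {(r, s). split_output p outA outB (x, r) (y, s) = (\<chi> i. Some (f x y $ i))}"
    using computes unfolding computes_priv_def by blast
  also have "\<dots> \<le> out_prob x y {(u, v). (u \<bowtie> v) $ i = Some (f x y $ i)}"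
    unfolding out_prob_def
    by (rule measure_pmf.finite_measure_mono) (auto simp: split_output_def)
  finally show ?thesis .
qed

lemma out_prob_incorrect:
  assumes "\<And>u v. (u, v) \<in> U \<Longrightarrow> (u \<bowtie> v) $ i \<noteq> Some (f x y $ i)"
  shows "out_prob x y U \<le> \<epsilon>"
proof -
  have "out_prob x y U + out_prob x y {(u, v). (u \<bowtie> v) $ i = Some (f x y $ i)} \<le> 1"
    using assms by (subst out_prob_Un[symmetric]) (auto simp: out_prob_bounds)
  then show ?thesis using out_prob_correct[of x y i] by linarith
qed

section \<open>Estimating output probabilities from rounded factors\<close>

abbreviation says :: "'k \<Rightarrow> bool option \<Rightarrow> (bool option ^ 'k) set" where
  "says i v \<equiv> {u. u $ i = v}"

definition a_rnd :: "nat \<Rightarrow> 'x \<Rightarrow> bool list \<Rightarrow> real" where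
  "a_rnd n x = (\<lambda>t\<in>transcripts. rnd n (a_out x t UNIV))"

definition b_rnd :: "nat \<Rightarrow> 'y \<Rightarrow> bool list \<Rightarrow> real" where
  "b_rnd n y = (\<lambda>t\<in>transcripts. rnd n (b_out y t UNIV))"

text \<open>Each of the at most \<open>2 ^ R\<close> transcripts contributes an error of at most
  \<open>1 / 2 ^ n\<close>.\<close>

lemma sum_rounding_error:
  fixes z z' w :: "bool list \<Rightarrow> real"
  assumes "\<And>t. t \<in> transcripts \<Longrightarrow> 0 \<le> w t \<and> w t \<le> 1"
    and "\<And>t. t \<in> transcripts \<Longrightarrow> \<bar>z' t - z t\<bar> \<le> 1 / 2 ^ n"
  shows "\<bar>(\<Sum>t\<in>transcripts. w t * z' t) - (\<Sum>t\<in>transcripts. w t * z t)\<bar> \<le> 2 ^ R / 2 ^ n"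
proof -
  have "\<bar>(\<Sum>t\<in>transcripts. w t * z' t) - (\<Sum>t\<in>transcripts. w t * z t)\<bar>
      \<le> (\<Sum>t\<in>transcripts. \<bar>w t * (z' t - z t)\<bar>)"
    by (simp only: sum_subtractf[symmetric] right_diff_distrib[symmetric] sum_abs)
  also have "\<dots> \<le> (\<Sum>t\<in>transcripts. 1 * (1 / 2 ^ n))"
    unfolding abs_mult using assms by (intro sum_mono mult_mono) auto
  also have "\<dots> \<le> 2 ^ R / 2 ^ n"
    using card_transcripts by (simp add: divide_right_mono)
  finally show ?thesis .
qed

subsection \<open>Error below one third\<close>

text \<open>Let \<delta> = 1/3 - \<epsilon>. The estimates are accurate to \<delta>/4; a wrong bit
  has probability at most \<epsilon>, and for one of the parties the right bit has probability at
  least 1/3 + \<delta>/2. The threshold \<open>\<theta>\<close>, midway between \<epsilon> and 1/3,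
  separates the two.\<close>

lemma D_spt_le_third:
  assumes n: "2 ^ R / 2 ^ n \<le> (1 / 3 - \<epsilon>) / 4" and eps: "\<epsilon> < 1 / 3"
  shows "D_spt f \<le> enat (n * card transcripts + n * card transcripts + CARD('k))"
proof -
  define \<theta> where "\<theta> = \<epsilon> + (1 / 3 - \<epsilon>) / 2"
  \<comment> \<open>Each party knows its own output probabilities exactly and uses only the other's
    factors in rounded form.\<close>
  define estA where "estA = (\<lambda>\<beta> x i v. \<Sum>t\<in>transcripts. a_out x t (says i (Some v)) * \<beta> t)"
  define estB where "estB = (\<lambda>\<alpha> y i v. \<Sum>t\<in>transcripts. b_out y t (says i (Some v)) * \<alpha> t)"
  define oa where "oa = (\<lambda>\<beta> x. \<chi> i.
     if \<exists>v. estA \<beta> x i v > \<theta> then Some (SOME v. estA \<beta> x i v > \<theta>) else None)"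
  \<comment> \<open>The third message, \<open>CARD('k)\<close> bits: the coordinates that Alice
    answers. Bob leaves these blank, since two answers would weave to *.\<close>
  define z where "z = (\<lambda>\<beta> x. {i. \<exists>v. estA \<beta> x i v > \<theta>})"
  define ob :: "(bool list \<Rightarrow> real) \<Rightarrow> 'k set \<Rightarrow> 'y \<Rightarrow> bool option ^ 'k" where
    "ob = (\<lambda>\<alpha> S y. \<chi> i. if i \<in> S then None else Some (SOME v. estB \<alpha> y i v > \<theta>))"
  have PA: "\<bar>estA (b_rnd n y) x i v - out_prob x y (says i (Some v) \<times> UNIV)\<bar> \<le> (1 / 3 - \<epsilon>) / 4" for x y i v
    unfolding estA_def out_prob_product
    by (rule order_trans[OF sum_rounding_error n])
      (auto simp: b_rnd_def a_out_bounds b_out_bounds rnd_error)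
  have PB: "\<bar>estB (a_rnd n x) y i v - out_prob x y (UNIV \<times> says i (Some v))\<bar> \<le> (1 / 3 - \<epsilon>) / 4" for x y i v
    unfolding estB_def out_prob_product
    by (subst (2) mult.commute, rule order_trans[OF sum_rounding_error n])
      (auto simp: a_rnd_def a_out_bounds b_out_bounds rnd_error)
  have wrongA: "v = f x y $ i" if "estA (b_rnd n y) x i v > \<theta>" for x y i v
  proof (rule ccontr)
    assume "v \<noteq> f x y $ i"
    then have "out_prob x y (says i (Some v) \<times> UNIV) \<le> \<epsilon>"
      by (intro out_prob_incorrect) (auto simp: weave_eq_Some_iff)
    then show False using that PA[of y x i v] eps by (simp add: \<theta>_def abs_le_iff field_simps)
  qed
  have wrongB: "v = f x y $ i" if "estB (a_rnd n x) y i v > \<theta>" for x y i v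
  proof (rule ccontr)
    assume "v \<noteq> f x y $ i"
    then have "out_prob x y (UNIV \<times> says i (Some v)) \<le> \<epsilon>"
      by (intro out_prob_incorrect) (auto simp: weave_eq_Some_iff)
    then show False using that PB[of x y i v] eps by (simp add: \<theta>_def abs_le_iff field_simps)
  qed
  have one_right: "estA (b_rnd n y) x i (f x y $ i) > \<theta> \<or> estB (a_rnd n x) y i (f x y $ i) > \<theta>" for x y i
  proof -
    let ?v = "f x y $ i"
    have "1 - \<epsilon> \<le> out_prob x y (says i (Some ?v) \<times> UNIV \<union> UNIV \<times> says i (Some ?v))"
      by (rule order_trans[OF out_prob_correct[of x y i] out_prob_mono])
        (auto simp: weave_eq_Some_iff)
    also have "\<dots> \<le> out_prob x y (says i (Some ?v) \<times> UNIV) + out_prob x y (UNIV \<times> says i (Some ?v))"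
      by (rule out_prob_Un_le)
    finally have "1 - \<epsilon> \<le> out_prob x y (says i (Some ?v) \<times> UNIV) + out_prob x y (UNIV \<times> says i (Some ?v))" .
    moreover have "out_prob x y (says i (Some ?v) \<times> UNIV) \<le> estA (b_rnd n y) x i ?v + (1 / 3 - \<epsilon>) / 4"
      using PA[of y x i ?v] by linarith
    moreover have "out_prob x y (UNIV \<times> says i (Some ?v)) \<le> estB (a_rnd n x) y i ?v + (1 / 3 - \<epsilon>) / 4"
      using PB[of x y i ?v] by linarith
    \<comment> \<open>The middle term pays for the two rounding errors; the last one is positive
      slack.\<close>
    moreover have "1 - \<epsilon> = 2 * \<theta> + (1 / 3 - \<epsilon>) / 2 + 3 / 2 * (1 / 3 - \<epsilon>)"
      by (simp add: \<theta>_def field_simps)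
    ultimately show ?thesis using eps by argo
  qed
  have out: "(oa (b_rnd n y) x \<bowtie> ob (a_rnd n x) (z (b_rnd n y) x) y) $ i = Some (f x y $ i)" for x y i
  proof (cases "i \<in> z (b_rnd n y) x")
    case True
    then have ex: "\<exists>v. estA (b_rnd n y) x i v > \<theta>" by (simp add: z_def)
    have "(SOME v. estA (b_rnd n y) x i v > \<theta>) = f x y $ i"
      by (rule wrongA[OF someI_ex[OF ex]])
    then show ?thesis using True ex by (simp add: weave_eq_Some_iff oa_def ob_def)
  next
    case False
    then have nex: "\<not> (\<exists>v. estA (b_rnd n y) x i v > \<theta>)" by (simp add: z_def)
    then have ex: "\<exists>v. estB (a_rnd n x) y i v > \<theta>" using one_right by blast
    have "(SOME v. estB (a_rnd n x) y i v > \<theta>) = f x y $ i"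
      by (rule wrongB[OF someI_ex[OF ex]])
    then show ?thesis using False nex by (simp add: weave_eq_Some_iff oa_def ob_def)
  qed
  let ?V = "PiE transcripts (\<lambda>_. grid n)"
  have "range (a_rnd n) \<subseteq> ?V" "range (b_rnd n) \<subseteq> ?V"
    by (auto simp: a_rnd_def b_rnd_def rnd_in_grid)
  moreover have "card (UNIV :: 'k set set) \<le> 2 ^ CARD('k)"
    using card_Pow[of "UNIV :: 'k set"] by simp
  ultimately show ?thesis
    using card_PiE_grid[OF transcripts(1), of n]
    by (intro D_spt_le_three_rounds[where V = ?V and V' = ?V and W = UNIV
          and h = "a_rnd n" and h' = "b_rnd n" and z = z and oa = oa and ob = ob and f = f,
          OF _ _ _ _ _ _ _ _ _ out]) auto
qed

subsection \<open>Error below one half\<close>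

text \<open>On transcripts of probability zero this is \<open>0 / 0 = 0\<close>, which is harmless.\<close>

definition a_cond :: "'x \<Rightarrow> bool list \<Rightarrow> 'k \<Rightarrow> bool option \<Rightarrow> real" where
  "a_cond x t i v = a_out x t (says i v) / a_out x t UNIV"

lemma a_cond_bounds: "0 \<le> a_cond x t i v" "a_cond x t i v \<le> 1"
  using a_out_bounds[of x t UNIV] a_out_bounds[of x t "says i v"]
  by (auto simp: a_cond_def divide_le_eq_1)

text \<open>If the denominator of \<open>a_cond\<close> vanishes, so does the left-hand side, by
  monotonicity.\<close>

lemma a_out_says: "a_out x t (says i v) = a_out x t UNIV * a_cond x t i v"
  using a_out_bounds[of x t "says i v"] by (auto simp: a_cond_def)

text \<open>Only Alice speaks. Let \<delta> = 1/2 - \<epsilon>. Bob's estimates err by at most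
  \<delta>/8 + \<delta>/2 each, together 5\<delta>/4, while the right and the wrong bit differ in
  probability by at least 2\<delta>. The factor 3 counts the values of
  \<open>bool option\<close>.\<close>

lemma D_spt_le_half:
  assumes n: "2 ^ R / 2 ^ n \<le> (1 / 2 - \<epsilon>) / 8" and n': "1 / 2 ^ n' \<le> (1 / 2 - \<epsilon>) / 2"
    and eps: "\<epsilon> < 1 / 2"
  shows "D_spt f \<le> enat (n * card transcripts + n' * (card transcripts * CARD('k) * 3))"
proof -
  let ?I = "transcripts \<times> (UNIV :: 'k set) \<times> (UNIV :: bool option set)"
  define c_rnd where "c_rnd = (\<lambda>x. \<lambda>(t, i, v)\<in>?I. rnd n' (a_cond x t i v))"
  \<comment> \<open>A coordinate has value \<open>v\<close> when exactly one party announces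
    \<open>v\<close> and the other leaves it blank. Bob's probabilities are exact,
    \<open>\<gamma>\<close> stands for Alice's conditional ones.\<close>
  define F where "F = (\<lambda>y i v t \<gamma>. \<gamma> (t, i, Some v) * b_out y t (says i None)
     + \<gamma> (t, i, None) * b_out y t (says i (Some v)))"
  define est where "est = (\<lambda>(\<alpha>, \<gamma>) y i v. \<Sum>t\<in>transcripts. F y i v t \<gamma> * \<alpha> t)"
  define ob :: "_ \<Rightarrow> unit \<Rightarrow> 'y \<Rightarrow> bool option ^ 'k" where
    "ob = (\<lambda>m _ y. \<chi> i. Some (est m y i False < est m y i True))"
  have err: "\<bar>est (a_rnd n x, c_rnd x) y i v - out_prob x y {(u, w). (u \<bowtie> w) $ i = Some v}\<bar>
      \<le> (1 / 2 - \<epsilon>) / 8 + (1 / 2 - \<epsilon>) / 2" for x y i v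
  proof -
    let ?c = "\<lambda>(t, i, v). a_cond x t i v"
    have w: "b_out y t (says i None) + b_out y t (says i (Some v)) \<le> b_out y t UNIV" for t
      by (rule b_out_disjoint) auto
    have bnd: "0 \<le> F y i v t (c_rnd x) \<and> F y i v t (c_rnd x) \<le> 1" if "t \<in> transcripts" for t
    proof -
      have c: "0 \<le> c_rnd x (t, j) \<and> c_rnd x (t, j) \<le> 1" for j
        using that grid_bounds[OF rnd_in_grid] by (cases j) (auto simp: c_rnd_def)
      have "F y i v t (c_rnd x) \<le> 1 * b_out y t (says i None) + 1 * b_out y t (says i (Some v))"
        unfolding F_def using c b_out_bounds by (intro add_mono mult_right_mono) auto
      then show ?thesis using w[of t] c b_out_bounds(1) b_out_bounds(2)[of y t UNIV] by (auto simp: F_def)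
    qed
    have 1: "\<bar>est (a_rnd n x, c_rnd x) y i v - (\<Sum>t\<in>transcripts. F y i v t (c_rnd x) * a_out x t UNIV)\<bar>
        \<le> (1 / 2 - \<epsilon>) / 8"
      unfolding est_def prod.case
      by (rule order_trans[OF sum_rounding_error n])
        (auto simp: bnd a_rnd_def a_out_bounds rnd_error)
    \<comment> \<open>The error keeps the factor \<open>b_out y t UNIV\<close>. Weighted by Alice's
      factor and summed, it is multiplied by total probability 1, not by the number of transcripts;
      hence the precision \<open>n'\<close> need not grow with \<open>R\<close>.\<close>
    have Fdiff: "\<bar>F y i v t (c_rnd x) - F y i v t ?c\<bar> \<le> 1 / 2 ^ n' * b_out y t UNIV"
      if t: "t \<in> transcripts" for t
    proof -
      have c: "\<bar>c_rnd x (t, j) - ?c (t, j)\<bar> \<le> 1 / 2 ^ n'" for j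
        using t by (cases j) (auto simp: c_rnd_def a_cond_bounds rnd_error)
      have "F y i v t (c_rnd x) - F y i v t ?c
          = (c_rnd x (t, i, Some v) - ?c (t, i, Some v)) * b_out y t (says i None)
            + (c_rnd x (t, i, None) - ?c (t, i, None)) * b_out y t (says i (Some v))"
        unfolding F_def by (simp add: algebra_simps)
      also have "\<bar>\<dots>\<bar> \<le> 1 / 2 ^ n' * b_out y t (says i None) + 1 / 2 ^ n' * b_out y t (says i (Some v))"
        by (rule order_trans[OF abs_triangle_ineq])
          (unfold abs_mult abs_of_nonneg[OF b_out_bounds(1)],
            intro add_mono mult_right_mono c b_out_bounds(1))
      also have "\<dots> \<le> 1 / 2 ^ n' * b_out y t UNIV"
        unfolding distrib_left[symmetric] using w by (rule mult_left_mono) simp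
      finally show ?thesis .
    qed
    have "\<bar>(\<Sum>t\<in>transcripts. F y i v t (c_rnd x) * a_out x t UNIV)
        - (\<Sum>t\<in>transcripts. F y i v t ?c * a_out x t UNIV)\<bar>
        \<le> (\<Sum>t\<in>transcripts. \<bar>(F y i v t (c_rnd x) - F y i v t ?c) * a_out x t UNIV\<bar>)"
      by (simp only: sum_subtractf[symmetric] left_diff_distrib[symmetric] sum_abs)
    also have "\<dots> \<le> (\<Sum>t\<in>transcripts. (1 / 2 ^ n' * b_out y t UNIV) * a_out x t UNIV)"
      unfolding abs_mult abs_of_nonneg[OF a_out_bounds(1)]
      by (intro sum_mono mult_right_mono Fdiff a_out_bounds(1))
    also have "\<dots> = 1 / 2 ^ n' * (\<Sum>t\<in>transcripts. a_out x t UNIV * b_out y t UNIV)"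
      unfolding sum_distrib_left by (intro sum.cong) auto
    also have "\<dots> \<le> (1 / 2 - \<epsilon>) / 2" unfolding out_prob_UNIV using n' by simp
    finally have 2: "\<bar>(\<Sum>t\<in>transcripts. F y i v t (c_rnd x) * a_out x t UNIV)
        - (\<Sum>t\<in>transcripts. F y i v t ?c * a_out x t UNIV)\<bar> \<le> (1 / 2 - \<epsilon>) / 2" .
    have "{(u, w). (u \<bowtie> w) $ i = Some v}
        = says i (Some v) \<times> says i None \<union> says i None \<times> says i (Some v)"
      by (auto simp: weave_eq_Some_iff)
    then have "out_prob x y {(u, w). (u \<bowtie> w) $ i = Some v}
        = out_prob x y (says i (Some v) \<times> says i None) + out_prob x y (says i None \<times> says i (Some v))"
      by (simp only:) (rule out_prob_Un, auto)
    also have "\<dots> = (\<Sum>t\<in>transcripts. F y i v t ?c * a_out x t UNIV)"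
      unfolding out_prob_product sum.distrib[symmetric] F_def a_out_says
      by (intro sum.cong) (auto simp: algebra_simps)
    finally show ?thesis using 1 2 by linarith
  qed
  have out: "((\<chi> i. None) \<bowtie> ob (a_rnd n x, c_rnd x) () y) $ i = Some (f x y $ i)" for x y i
  proof -
    have "out_prob x y {(u, w). (u \<bowtie> w) $ i = Some (\<not> f x y $ i)} \<le> \<epsilon>"
      by (rule out_prob_incorrect[where i = i]) auto
    then have "est (a_rnd n x, c_rnd x) y i (\<not> f x y $ i) < est (a_rnd n x, c_rnd x) y i (f x y $ i)"
      using err[of x y i "f x y $ i"] err[of x y i "\<not> f x y $ i"] out_prob_correct[of x y i] eps
      unfolding abs_le_iff by (simp add: field_simps)
    then show ?thesis
      by (cases "f x y $ i") (auto simp: weave_eq_Some_iff ob_def)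
  qed
  let ?V = "PiE transcripts (\<lambda>_. grid n) \<times> PiE ?I (\<lambda>_. grid n')"
  have I: "finite ?I" "card ?I = card transcripts * CARD('k) * 3"
    using transcripts(1) by (simp_all add: card_cartesian_product UNIV_option_conv card_image card_UNIV_bool)
  have "range (\<lambda>x. (a_rnd n x, c_rnd x)) \<subseteq> ?V"
    by (auto simp: a_rnd_def c_rnd_def rnd_in_grid split: if_splits)
  moreover have "finite ?V" "card ?V \<le> 2 ^ (n * card transcripts + n' * (card transcripts * CARD('k) * 3))"
    using card_PiE_grid[OF transcripts(1), of n] card_PiE_grid[OF I(1), of n'] I(2)
    by (auto simp: card_cartesian_product power_add mult.assoc intro!: mult_mono)
  ultimately have "D_spt f \<le> enat (n * card transcripts + n' * (card transcripts * CARD('k) * 3) + 0 + 0)"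
    by (intro D_spt_le_three_rounds[where V = ?V and V' = "UNIV :: unit set" and W = "UNIV :: unit set"
          and oa = "\<lambda>_ _. \<chi> i. None" and ob = ob and h' = "\<lambda>_. ()" and z = "\<lambda>_ _. ()"
          and h = "\<lambda>x. (a_rnd n x, c_rnd x)" and f = f,
          OF _ _ _ _ _ _ _ _ _ out]) auto
  then show ?thesis by simp
qed

end

section \<open>From the private-coin complexity to the two bounds\<close>

lemma R_spt_priv_attained:
  assumes "R_spt_priv \<epsilon> f = enat R"
  obtains A B p outA outB where "private_protocol \<epsilon> f A B p outA outB R"
proof -
  let ?S = "{enat (cost (UNIV \<times> set_pmf A) (UNIV \<times> set_pmf B) p) | A B p outA outB.
            computes_priv \<epsilon> f A B p outA outB}"
  \<comment> \<open>A finite infimum in \<open>enat\<close> is a least element; the empty set has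
    infimum \<infinity>.\<close>
  have "s \<in> S" if "Inf S = enat s'" "s = enat s'" for s s' and S :: "enat set"
    using that LeastI_ex[of "\<lambda>s. s \<in> S"] by (auto simp: Inf_enat_def split: if_splits)
  then have "enat R \<in> ?S" using assms unfolding R_spt_priv_def by blast
  then show thesis using that by (auto simp: private_protocol_def)
qed

text \<open>Bounding the logarithm linearly, by ln w \<le> w - 1 and ln 2 \<ge> 1/2, already
  suffices. It is applied with \<open>u = 1 / \<gamma>\<close>, which turns the right-hand side into
  \<open>M / 2 ^ R\<close>.\<close>

lemma conditional_rounding_bits:
  fixes u :: real
  assumes "2 \<le> u" "real n \<le> log 2 (2 * u) + 1"
  shows "3 * real n \<le> 16 * u\<^sup>2"
proof -
  have "ln (2 * u) \<le> 2 * u - 1" using assms by (intro ln_le_minus_one) auto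
  moreover have "1 / 2 \<le> ln (2 :: real)" using ln2_ge_two_thirds by simp
  ultimately have "log 2 (2 * u) \<le> (2 * u - 1) / (1 / 2)"
    unfolding log_def using assms by (intro frac_le) auto
  also have "\<dots> = 4 * u - 2" by simp
  finally have "3 * real n \<le> 12 * u" using assms by linarith
  also have "\<dots> \<le> 16 * u\<^sup>2" using assms by (simp add: power2_eq_square)
  finally show ?thesis .
qed

theorem mainTheorem18:
  fixes f :: "'x \<Rightarrow> 'y \<Rightarrow> bool ^ 'k" and \<epsilon> M :: real and R :: nat
  assumes "0 < \<epsilon>" and "\<epsilon> < 1 / 2"
    and "R_spt_priv \<epsilon> f = enat R"
    and "M = 16 * (1 / 2 - \<epsilon>) powi (- 2) * 2 ^ R"
  shows "(\<epsilon> < 1 / 3 \<longrightarrow>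
            ereal_of_enat (D_spt f)
              \<le> ereal (2 ^ (R + 1) * (real R + log 2 (4 / (1 / 3 - \<epsilon>)) + 1) + real CARD('k)))
       \<and> ereal_of_enat (D_spt f)
           \<le> ereal (2 ^ (R + 1) * (real R + log 2 (8 / (1 / 2 - \<epsilon>)) + 1)
                      + real CARD('k) * ((5 - 2 * \<epsilon>) / 4 * M + 1))"
proof -
  obtain A B p outA outB where "private_protocol \<epsilon> f A B p outA outB R"
    using R_spt_priv_attained assms(3) by blast
  then interpret private_protocol \<epsilon> f A B p outA outB R .
  let ?T = "real (card transcripts)"
  have bound: "ereal_of_enat (D_spt f) \<le> ereal X" if "D_spt f \<le> enat c" "real c \<le> X" for c X
  proof -
    have "ereal_of_enat (D_spt f) \<le> ereal_of_enat (enat c)"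
      using that(1) by (simp only: ereal_of_enat_le_iff)
    also have "\<dots> \<le> ereal X" using that(2) by simp
    finally show ?thesis .
  qed
  have leaves: "?T * real n \<le> 2 ^ R * L" if "real n \<le> L" for n L
    using that card_transcripts by (intro mult_mono) auto
  have third: "ereal_of_enat (D_spt f)
      \<le> ereal (2 ^ (R + 1) * (real R + log 2 (4 / (1 / 3 - \<epsilon>)) + 1) + real CARD('k))"
    if eps: "\<epsilon> < 1 / 3"
  proof -
    have "1 \<le> 4 / (1 / 3 - \<epsilon>)" using eps assms(1) by (simp add: field_simps)
    then obtain n where n: "real n \<le> real R + log 2 (4 / (1 / 3 - \<epsilon>)) + 1"
        "2 ^ R / 2 ^ n \<le> 1 / (4 / (1 / 3 - \<epsilon>))"
      using rounding_bits by blast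
    from n(2) have "2 ^ R / 2 ^ n \<le> (1 / 3 - \<epsilon>) / 4" by simp
    from D_spt_le_third[OF this eps] leaves[OF n(1)] show ?thesis
      by (intro bound) (auto simp: mult.commute)
  qed
  have half: "ereal_of_enat (D_spt f)
      \<le> ereal (2 ^ (R + 1) * (real R + log 2 (8 / (1 / 2 - \<epsilon>)) + 1)
                 + real CARD('k) * ((5 - 2 * \<epsilon>) / 4 * M + 1))"
  proof -
    define \<gamma> where "\<gamma> = 1 / 2 - \<epsilon>"
    have \<gamma>: "0 < \<gamma>" "\<gamma> < 1 / 2" using assms by (auto simp: \<gamma>_def)
    define L where "L = real R + log 2 (8 / \<gamma>) + 1"
    have "1 \<le> 8 / \<gamma>" "1 \<le> 2 / \<gamma>" using \<gamma> by (auto simp: field_simps)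
    \<comment> \<open>The precision \<open>n'\<close> comes from \<open>rounding_bits\<close> with 0
      in place of \<open>R\<close>.\<close>
    then obtain n n' where n: "real n \<le> L" "2 ^ R / 2 ^ n \<le> 1 / (8 / \<gamma>)"
      and n': "real n' \<le> real 0 + log 2 (2 / \<gamma>) + 1" "2 ^ 0 / 2 ^ n' \<le> 1 / (2 / \<gamma>)"
      using rounding_bits unfolding L_def by metis
    have D: "D_spt f \<le> enat (n * card transcripts + n' * (card transcripts * CARD('k) * 3))"
      using n(2) n'(2) assms(2) by (intro D_spt_le_half) (auto simp: \<gamma>_def)
    have "0 \<le> L" using n(1) by (smt (verit) of_nat_0_le_iff)
    have "3 * real n' \<le> 16 * (1 / \<gamma>)\<^sup>2"
      using \<gamma> n'(1) by (intro conditional_rounding_bits) (auto simp: field_simps)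
    then have "3 * real n' * ?T \<le> 16 * (1 / \<gamma>)\<^sup>2 * 2 ^ R"
      by (intro mult_mono[OF _ card_transcripts]) auto
    also have "\<dots> = M"
      unfolding assms(4) \<gamma>_def by (simp add: power_int_minus power_one_over inverse_eq_divide)
    finally have le_M: "3 * real n' * ?T \<le> M" .
    then have "0 \<le> M" by (smt (verit) mult_nonneg_nonneg of_nat_0_le_iff)
    \<comment> \<open>Here \<epsilon> < 1/2 makes the coefficient at least 1.\<close>
    then have "1 * M \<le> (5 - 2 * \<epsilon>) / 4 * M" using assms by (intro mult_right_mono) auto
    with le_M have "3 * real n' * ?T \<le> (5 - 2 * \<epsilon>) / 4 * M + 1" by linarith
    then have "real CARD('k) * (3 * real n' * ?T) \<le> real CARD('k) * ((5 - 2 * \<epsilon>) / 4 * M + 1)"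
      by (rule mult_left_mono) simp
    \<comment> \<open>Only Alice sends factors in this protocol, so \<open>2 ^ R * L\<close> bits
      cover them.\<close>
    moreover have "?T * real n \<le> 2 ^ (R + 1) * L"
    proof -
      have "0 \<le> 2 ^ R * L" using \<open>0 \<le> L\<close> by simp
      then show ?thesis using leaves[OF n(1)] by simp
    qed
    moreover have "real (n * card transcripts + n' * (card transcripts * CARD('k) * 3))
        = ?T * real n + real CARD('k) * (3 * real n' * ?T)" by simp
    ultimately have "real (n * card transcripts + n' * (card transcripts * CARD('k) * 3))
        \<le> 2 ^ (R + 1) * L + real CARD('k) * ((5 - 2 * \<epsilon>) / 4 * M + 1)"
      by linarith
    with D show ?thesis unfolding L_def \<gamma>_def by (rule bound)
  qed
  show ?thesis using third half by blast
qed

end
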